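(* For every positive integer $n$, the unique shape of $(p,n)$-prismatic polyominoes, where $p$ is the square tetromino, is the $(n^2+1)\times(n^2+1)$ square.
   Context: Cells are the unit squares of the square lattice, indexed by integer coordinates $(x,y)$. A polyomino is a finite nonempty edge-connected set of cells; its size is its number of cells; polyominoes are considered up to translation. The square tetromino is the $2\times2$ block $\{(0,0),(1,0),(0,1),(1,1)\}$. An $n$-coloring of a set of cells assigns each cell a color in $\{1,\dots,n\}$. An instance of a shape $p$ is a translate of $p$; an instance contained in a colored set is colored by restriction, and two instances have the same coloring if the colorings agree under the translation between them. A de Bruijn polyomino for $(p,n)$ is an $n$-colored polyomino containing exactly one instance of each of the $n^{|p|}$ distinct $n$-colorings of $p$; a $(p,n)$-prismatic polyomino is a de Bruijn polyomino for $(p,n)$ of minimum size. *)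

theory Defs
  imports Main "HOL-Library.FuncSet" "HOL-Library.Product_Plus"
begin

type_synonym cell = "int \<times> int"

definition adjacent :: "cell \<Rightarrow> cell \<Rightarrow> bool" where
  "adjacent a b \<longleftrightarrow> \<bar>fst a - fst b\<bar> + \<bar>snd a - snd b\<bar> = 1"

definition edge_connected :: "cell set \<Rightarrow> bool" where
  "edge_connected P \<longleftrightarrow>
    (\<forall>a\<in>P. \<forall>b\<in>P. (a, b) \<in> {(x, y). x \<in> P \<and> y \<in> P \<and> adjacent x y}\<^sup>*)"

definition polyomino :: "cell set \<Rightarrow> bool" where
  "polyomino P \<longleftrightarrow> finite P \<and> P \<noteq> {} \<and> edge_connected P"

definition translate :: "cell \<Rightarrow> cell set \<Rightarrow> cell set" where
  "translate v P = (\<lambda>x. x + v) ` P"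

definition shape :: "cell set \<Rightarrow> cell set set" where
  "shape P = range (\<lambda>v. translate v P)"

definition colorings :: "nat \<Rightarrow> cell set \<Rightarrow> (cell \<Rightarrow> nat) set" where
  "colorings n S = S \<rightarrow>\<^sub>E {1..n}"

text \<open>Instances of \<open>p\<close> are counted by their translation vectors; for finite nonempty \<open>p\<close>
  distinct vectors give distinct translates, so this is the number of instances.\<close>

definition de_bruijn_polyomino ::
    "cell set \<Rightarrow> nat \<Rightarrow> cell set \<Rightarrow> (cell \<Rightarrow> nat) \<Rightarrow> bool" where
  "de_bruijn_polyomino p n P f \<longleftrightarrow>
    polyomino P \<and> f \<in> colorings n P \<and>
    (\<forall>c \<in> colorings n p. \<exists>!v. translate v p \<subseteq> P \<and> (\<forall>x\<in>p. f (x + v) = c x))"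

definition prismatic_polyomino ::
    "cell set \<Rightarrow> nat \<Rightarrow> cell set \<Rightarrow> (cell \<Rightarrow> nat) \<Rightarrow> bool" where
  "prismatic_polyomino p n P f \<longleftrightarrow>
    de_bruijn_polyomino p n P f \<and>
    (\<forall>Q g. de_bruijn_polyomino p n Q g \<longrightarrow> card P \<le> card Q)"

definition square_tetromino :: "cell set" where
  "square_tetromino = {(0, 0), (1, 0), (0, 1), (1, 1)}"

definition square_block :: "nat \<Rightarrow> cell set" where
  "square_block m = {0..<int m} \<times> {0..<int m}"

end

theory Submission
  imports Defs "HOL-Library.Discrete_Functions"
begin

text \<open>
  Lower bound: the set \<open>A\<close> of translation vectors of the tetromino has \<open>n\<^sup>4\<close> elements, and if \<open>A\<close>
  meets \<open>r\<close> columns and \<open>c\<close> rows, then \<open>\<bar>A + {0,1}\<^sup>2\<bar> \<ge> \<bar>A\<bar> + r + c + 1\<close> while \<open>r c \<ge> \<bar>A\<bar>\<close>. Hence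
  \<open>\<bar>P\<bar> \<ge> (n\<^sup>2 + 1)\<^sup>2\<close>, and equality forces \<open>A\<close> to be a product of two intervals of length \<open>n\<^sup>2\<close>.

  Existence: take a cyclic sequence of length \<open>n\<^sup>2\<close> containing every ordered pair of colors exactly once,
  and let column \<open>x\<close> of the square be this sequence read cyclically from position \<open>x (x - 1) / 2\<close>.
  The two columns of a window determine two positions in the sequence; their difference modulo
  \<open>n\<^sup>2\<close> is the abscissa of the window, and then the first position determines the ordinate.
\<close>

section \<open>Sets of cells with few translates\<close>

lemma card_Un_succ_ge:
  fixes R :: "int set"
  assumes "finite R" "R \<noteq> {}"
  shows "card R + 1 \<le> card (R \<union> (\<lambda>x. x + 1) ` R)"
proof -
  have "Max R + 1 \<notin> R" using Max_ge[OF assms(1), of "Max R + 1"] by linarith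
  then have "card R + 1 = card (insert (Max R + 1) R)" using assms by simp
  also have "\<dots> \<le> card (R \<union> (\<lambda>x. x + 1) ` R)"
    using assms by (intro card_mono) auto
  finally show ?thesis .
qed

text \<open>\<open>Min R\<close> and the successors of the elements of \<open>R\<close> already make
  up \<open>card R + 1\<close> elements, so equality leaves no others. Hence every element of
  \<open>R\<close> except the minimum has its predecessor in \<open>R\<close>, and descending from
  \<open>Max R\<close> fills the interval.\<close>

lemma interval_if_card_Un_succ:
  fixes R :: "int set"
  assumes "finite R" "R \<noteq> {}" "card (R \<union> (\<lambda>x. x + 1) ` R) = card R + 1"
  shows "R = {Min R..<Min R + int (card R)}"
proof -
  let ?S = "insert (Min R) ((\<lambda>x. x + 1) ` R)"
  have "Min R - 1 \<notin> R" using Min_le[OF assms(1), of "Min R - 1"] by linarith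
  then have "Min R \<notin> (\<lambda>x. x + 1) ` R" by auto
  then have "card ?S = card R + 1"
    using assms by (simp add: card_image inj_on_def)
  then have "?S = R \<union> (\<lambda>x. x + 1) ` R"
    using assms by (intro card_subset_eq) auto
  then have S: "R \<subseteq> ?S" by blast
  have pred: "x - 1 \<in> R" if "x \<in> R" "x \<noteq> Min R" for x
    using subsetD[OF S that(1)] that(2) by auto
  have down: "Max R - int k \<in> R" if "int k \<le> Max R - Min R" for k
    using that
  proof (induction k)
    case 0
    then show ?case using assms by simp
  next
    case (Suc k)
    then show ?case using pred[of "Max R - int k"] by (simp add: algebra_simps)
  qed
  have "y \<in> R" if "Min R \<le> y" "y \<le> Max R" for y
    using down[of "nat (Max R - y)"] that by simp
  then have R: "R = {Min R..Max R}"
    using assms by (intro equalityI subsetI) simp_all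
  have "Min R \<le> Max R" using assms by simp
  then have "card R = nat (Max R - Min R + 1)"
    using arg_cong[OF R, of card] by simp
  then have "{Min R..Max R} = {Min R..<Min R + int (card R)}"
    using \<open>Min R \<le> Max R\<close> by auto
  with R show ?thesis by (rule trans)
qed

text \<open>Every nonempty column gains at least the cell above its topmost one.\<close>

lemma card_Un_shift_snd_ge:
  fixes A :: "cell set"
  assumes "finite A"
  shows "card A + card (fst ` A) \<le> card (A \<union> (\<lambda>v. v + (0, 1)) ` A)"
proof -
  define top where "top x = Max {y. (x, y) \<in> A}" for x
  have fin: "finite {y. (x, y) \<in> A}" for x
    by (rule finite_subset[OF _ finite_imageI[OF assms, of snd]]) (auto intro: rev_image_eqI)
  have top: "(x, top x) \<in> A" if "x \<in> fst ` A" for x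
  proof -
    have "{y. (x, y) \<in> A} \<noteq> {}" using that by force
    then show ?thesis using Max_in[OF fin] unfolding top_def by blast
  qed
  \<comment> \<open>This covers empty columns too, where \<open>top x\<close> is an unspecified
    value: no cell of such a column is in \<open>A\<close>.\<close>
  have ntop: "(x, top x + 1) \<notin> A" for x
    using Max_ge[OF fin] unfolding top_def by fastforce
  let ?N = "(\<lambda>x. (x, top x + 1)) ` fst ` A"
  have "card A + card (fst ` A) = card A + card ?N"
    by (simp add: card_image inj_on_def)
  also have "\<dots> = card (A \<union> ?N)"
    using ntop assms by (subst card_Un_disjoint) auto
  also have "\<dots> \<le> card (A \<union> (\<lambda>v. v + (0, 1)) ` A)"
  proof (intro card_mono)
    show "A \<union> ?N \<subseteq> A \<union> (\<lambda>v. v + (0, 1)) ` A"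
      using imageI[OF top, of _ "\<lambda>v. v + (0, 1)"] by auto
  qed (use assms in auto)
  finally show ?thesis .
qed

text \<open>Reflection in the diagonal exchanges rows and columns.\<close>

lemma card_Un_shift_fst_ge:
  fixes A :: "cell set"
  assumes "finite A"
  shows "card A + card (snd ` A) \<le> card (A \<union> (\<lambda>v. v + (1, 0)) ` A)"
proof -
  have "card (prod.swap ` A) + card (fst ` prod.swap ` A)
      \<le> card (prod.swap ` A \<union> (\<lambda>v. v + (0, 1)) ` prod.swap ` A)"
    using assms by (intro card_Un_shift_snd_ge) auto
  also have "prod.swap ` A \<union> (\<lambda>v. v + (0, 1)) ` prod.swap ` A
      = prod.swap ` (A \<union> (\<lambda>v. v + (1, 0)) ` A)"
    by (auto simp: image_Un image_image prod.swap_def)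
  finally show ?thesis
    by (simp add: card_image image_image)
qed

text \<open>The Minkowski sum of \<open>A\<close> with the 2 by 2 block.\<close>

definition block_sum :: "cell set \<Rightarrow> cell set" where
  "block_sum A = (\<Union>v\<in>A. translate v square_tetromino)"

lemma translate_square_tetromino:
  "translate (x, y) square_tetromino = {(x, y), (x + 1, y), (x, y + 1), (x + 1, y + 1)}"
  by (auto simp: translate_def square_tetromino_def add.commute)

lemma mem_block_sum_iff:
  "(x, y) \<in> block_sum A \<longleftrightarrow> (x, y) \<in> A \<or> (x - 1, y) \<in> A \<or> (x, y - 1) \<in> A \<or> (x - 1, y - 1) \<in> A"
proof -
  have "(x, y) \<in> translate v square_tetromino \<longleftrightarrow>
      v \<in> {(x, y), (x - 1, y), (x, y - 1), (x - 1, y - 1)}" for v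
    by (cases v) (auto simp: translate_square_tetromino)
  then show ?thesis by (auto simp: block_sum_def)
qed

lemma mem_shift_iff: "w \<in> (\<lambda>v. v + u) ` A \<longleftrightarrow> w - u \<in> A" for u w :: "'a :: group_add"
  by (metis (no_types, lifting) add_diff_cancel diff_add_cancel image_iff)

text \<open>The 2 by 2 block is the sum of a vertical and a horizontal domino. This reduces the size
  of the block sum to the two one-directional bounds.\<close>

lemma block_sum_eq:
  "block_sum A = (let B = A \<union> (\<lambda>v. v + (0, 1)) ` A in B \<union> (\<lambda>v. v + (1, 0)) ` B)"
  by (auto simp: Let_def mem_block_sum_iff mem_shift_iff)

lemma block_sum_Times:
  "block_sum (R \<times> C) = (R \<union> (\<lambda>x. x + 1) ` R) \<times> (C \<union> (\<lambda>x. x + 1) ` C)"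
  by (auto simp: mem_block_sum_iff mem_shift_iff)

text \<open>The vertical shift adds at least one cell per column of \<open>A\<close>. The horizontal
  shift then adds at least one per row of the enlarged set, which has at least one row more than
  \<open>A\<close>; this is the source of the final \<open>+ 1\<close>.\<close>

lemma card_block_sum_ge:
  assumes "finite A" "A \<noteq> {}"
  shows "card A + card (fst ` A) + card (snd ` A) + 1 \<le> card (block_sum A)"
proof -
  define B where "B = A \<union> (\<lambda>v. v + (0, 1)) ` A"
  have "snd ` B = snd ` A \<union> (\<lambda>x. x + 1) ` snd ` A"
    by (auto simp: B_def image_Un image_image)
  then have "card (snd ` A) + 1 \<le> card (snd ` B)"
    using card_Un_succ_ge[of "snd ` A"] assms by simp
  moreover have "card A + card (fst ` A) \<le> card B"
    unfolding B_def by (rule card_Un_shift_snd_ge) fact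
  moreover have "card B + card (snd ` B) \<le> card (block_sum A)"
    unfolding block_sum_eq Let_def B_def[symmetric]
    by (rule card_Un_shift_fst_ge) (use assms B_def in simp)
  ultimately show ?thesis by simp
qed

text \<open>Equality case of the AM-GM inequality:
  \<open>(r + c)\<^sup>2 \<le> 4 * m\<^sup>2 \<le> 4 * r * c\<close> forces
  \<open>(r - c)\<^sup>2 \<le> 0\<close>.\<close>

lemma eq_if_sum_le_prod_ge:
  fixes m r c :: nat
  assumes "m\<^sup>2 \<le> r * c" "r + c \<le> 2 * m"
  shows "r = m \<and> c = m"
proof -
  have "int (r + c) * int (r + c) \<le> int (2 * m) * int (2 * m)"
    using assms(2) by (intro mult_mono) auto
  moreover have "int (m\<^sup>2) \<le> int (r * c)" using assms(1) by (simp only: zle_int)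
  ultimately have "(int r - int c)\<^sup>2 \<le> 0" by (simp add: power2_eq_square algebra_simps)
  then have "r = c" by simp
  then have "m \<le> r" using assms(1) by (simp add: power2_eq_square[symmetric] power2_nat_le_eq_le)
  then show ?thesis using \<open>r = c\<close> assms(2) by simp
qed

lemma translate_Times: "translate (a, b) (R \<times> C) = (\<lambda>x. x + a) ` R \<times> (\<lambda>y. y + b) ` C"
  by (rule set_eqI) (auto simp: translate_def mem_shift_iff mem_Times_iff)

text \<open>The bound is an inequality so that the lemma serves twice: a smaller sum would also be a
  full square, which is absurd, and a sum of exactly this size is identified.\<close>

lemma block_sum_minimal:
  assumes A: "finite A" "card A = m\<^sup>2" and m: "m > 0" and le: "card (block_sum A) \<le> (m + 1)\<^sup>2"
  shows "\<exists>v. block_sum A = translate v (square_block (m + 1))"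
proof -
  let ?R = "fst ` A" and ?C = "snd ` A"
  have ne: "A \<noteq> {}" using A m by auto
  have sub: "A \<subseteq> ?R \<times> ?C" by force
  have "m\<^sup>2 \<le> card ?R * card ?C"
    using card_mono[OF _ sub] A by (simp add: card_cartesian_product)
  \<comment> \<open>With \<open>card A = m\<^sup>2\<close>, the general bound leaves
    \<open>(m + 1)\<^sup>2 - m\<^sup>2 - 1 = 2 * m\<close> for the two projections.\<close>
  moreover have "card ?R + card ?C \<le> 2 * m"
    using card_block_sum_ge[OF A(1) ne] le A by (simp add: power2_eq_square algebra_simps)
  ultimately have RC: "card ?R = m" "card ?C = m" using eq_if_sum_le_prod_ge by auto
  then have AA: "A = ?R \<times> ?C"
    using sub A by (intro card_subset_eq) (auto simp: card_cartesian_product power2_eq_square)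
  let ?R' = "?R \<union> (\<lambda>x. x + 1) ` ?R" and ?C' = "?C \<union> (\<lambda>x. x + 1) ` ?C"
  have bs: "block_sum A = ?R' \<times> ?C'" using block_sum_Times[of ?R ?C] AA by simp
  have fin: "finite ?R" "finite ?C" "?R \<noteq> {}" "?C \<noteq> {}" using A ne by auto
  have ge: "m + 1 \<le> card ?R'" "m + 1 \<le> card ?C'"
    using card_Un_succ_ge fin RC by metis+
  have prod: "card ?R' * card ?C' \<le> (m + 1) * (m + 1)"
    using le bs by (simp add: card_cartesian_product power2_eq_square)
  \<comment> \<open>Both factors are at least \<open>m + 1\<close> and their product is at most
    \<open>(m + 1)\<^sup>2\<close>, so neither is larger. This is the equality case on the line,
    which makes \<open>?R\<close> and \<open>?C\<close> intervals.\<close>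
  have "card ?R' * (m + 1) \<le> (m + 1) * (m + 1)"
    using prod ge(2) by (meson mult_le_mono2 order_trans)
  moreover have "(m + 1) * card ?C' \<le> (m + 1) * (m + 1)"
    using prod ge(1) by (meson mult_le_mono1 order_trans)
  ultimately have "card ?R' = card ?R + 1" "card ?C' = card ?C + 1"
    using ge RC by (auto simp del: mult_Suc mult_Suc_right)
  then obtain a b where "?R = {a..<a + int m}" "?C = {b..<b + int m}"
    using interval_if_card_Un_succ fin RC by metis
  moreover have "{a..<a + int m} \<union> (\<lambda>x. x + 1) ` {a..<a + int m} = {a..<a + int m + 1}" for a
    using m by auto
  ultimately have "block_sum A = {a..<a + int m + 1} \<times> {b..<b + int m + 1}"
    using bs by metis
  also have "\<dots> = translate (a, b) (square_block (m + 1))"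
    by (simp add: translate_Times square_block_def add_ac)
  finally show ?thesis by blast
qed

lemma shape_translate: "shape (translate v P) = shape P"
proof -
  have eq: "translate w (translate v P) = translate (v + w) P" for w
    by (simp add: translate_def image_image add.assoc)
  have "translate w (translate v P) \<in> shape P" for w
    unfolding eq shape_def by (rule rangeI)
  moreover have "translate w P \<in> shape (translate v P)" for w
    using eq[of "w - v"] unfolding shape_def by (metis add.commute diff_add_cancel rangeI)
  ultimately show ?thesis
    unfolding shape_def by (intro equalityI image_subsetI)
qed

section \<open>Windows of a de Bruijn polyomino\<close>

definition instances :: "cell set \<Rightarrow> cell set \<Rightarrow> cell set" where
  "instances p P = {v. translate v p \<subseteq> P}"

lemma finite_instances:
  assumes "finite P" "p \<noteq> {}"
  shows "finite (instances p P)"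
proof -
  obtain x where "x \<in> p" using assms by blast
  have "instances p P \<subseteq> (\<lambda>y. y - x) ` P"
  proof
    fix v assume "v \<in> instances p P"
    then have "x + v \<in> P" using \<open>x \<in> p\<close> by (auto simp: instances_def translate_def)
    then show "v \<in> (\<lambda>y. y - x) ` P" by (rule rev_image_eqI) simp
  qed
  then show ?thesis using assms finite_subset by blast
qed

text \<open>Reading off the coloring of each window is a bijection from the instances to the
  colorings of \<open>p\<close>: uniqueness in the de Bruijn property is injectivity, existence is
  surjectivity.\<close>

lemma card_instances:
  assumes "de_bruijn_polyomino p n P f" "finite p"
  shows "card (instances p P) = n ^ card p"
proof -
  define Q where "Q c v \<longleftrightarrow> v \<in> instances p P \<and> (\<forall>x\<in>p. f (x + v) = c x)" for c v
  have f: "f \<in> colorings n P" and ex: "\<And>c. c \<in> colorings n p \<Longrightarrow> \<exists>!v. Q c v"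
    using assms by (simp_all add: de_bruijn_polyomino_def Q_def instances_def)
  let ?w = "\<lambda>v. restrict (\<lambda>x. f (x + v)) p"
  have w: "?w v \<in> colorings n p" if "v \<in> instances p P" for v
  proof -
    have "f (x + v) \<in> {1..n}" if "x \<in> p" for x
      using f that \<open>v \<in> instances p P\<close> unfolding colorings_def instances_def translate_def
      by (intro PiE_mem[of f P]) auto
    then show ?thesis by (simp add: colorings_def)
  qed
  have Qw: "Q (?w v) v" if "v \<in> instances p P" for v
    using that by (simp add: Q_def)
  have "inj_on ?w (instances p P)"
  proof (rule inj_onI)
    fix u v assume uv: "u \<in> instances p P" "v \<in> instances p P" "?w u = ?w v"
    obtain z where z: "\<And>y. Q (?w v) y \<Longrightarrow> y = z"
      using ex[OF w[OF uv(2)]] by (rule ex1E) blast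
    show "u = v" using z[OF Qw[OF uv(1), unfolded uv(3)]] z[OF Qw[OF uv(2)]] by simp
  qed
  moreover have "?w ` instances p P = colorings n p"
  proof (intro equalityI subsetI)
    fix c assume c: "c \<in> colorings n p"
    then obtain v where v: "v \<in> instances p P" "\<And>x. x \<in> p \<Longrightarrow> f (x + v) = c x"
      using ex unfolding Q_def by blast
    \<comment> \<open>Both functions are \<open>undefined\<close> outside \<open>p\<close>, so
      agreement on \<open>p\<close> makes them equal.\<close>
    have "c \<in> extensional p" using c by (simp add: colorings_def PiE_def)
    then have "?w v = c" using v(2) by (intro extensionalityI[of _ p]) auto
    then show "c \<in> ?w ` instances p P" using v(1) by blast
  qed (use w in blast)
  ultimately have "card (instances p P) = card (colorings n p)"
    using card_image by metis
  then show ?thesis using assms(2) by (simp add: colorings_def card_PiE)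
qed

lemma card_square_block: "card (square_block k) = k\<^sup>2"
  by (simp add: square_block_def card_cartesian_product power2_eq_square)

text \<open>There are \<open>n ^ 4 = (n\<^sup>2)\<^sup>2\<close> translation vectors, so
  \<open>block_sum_minimal\<close> applies with \<open>m = n\<^sup>2\<close>.\<close>

lemma de_bruijn_square_tetromino_lower:
  assumes "de_bruijn_polyomino square_tetromino n P f" "n > 0"
  shows "(n\<^sup>2 + 1)\<^sup>2 \<le> card P"
    and "card P \<le> (n\<^sup>2 + 1)\<^sup>2 \<Longrightarrow> shape P = shape (square_block (n\<^sup>2 + 1))"
proof -
  let ?A = "instances square_tetromino P"
  have st: "finite square_tetromino" "card square_tetromino = 4" "square_tetromino \<noteq> {}"
    by (auto simp: square_tetromino_def)
  have finP: "finite P" using assms by (simp add: de_bruijn_polyomino_def polyomino_def)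
  have A: "finite ?A" "card ?A = (n\<^sup>2)\<^sup>2"
    using finite_instances finP st card_instances[OF assms(1)] by auto
  have sub: "block_sum ?A \<subseteq> P" by (auto simp: block_sum_def instances_def)
  then have le: "card (block_sum ?A) \<le> card P" using finP card_mono by blast
  have sq: "card (translate v (square_block k)) = k\<^sup>2" for v k
    by (simp add: translate_def card_image inj_on_def card_square_block)
  show *: "(n\<^sup>2 + 1)\<^sup>2 \<le> card P"
  proof (rule ccontr)
    assume "\<not> ?thesis"
    then have lt: "card (block_sum ?A) < (n\<^sup>2 + 1)\<^sup>2" using le by simp
    then obtain v where "block_sum ?A = translate v (square_block (n\<^sup>2 + 1))"
      using block_sum_minimal[OF A] assms by fastforce
    then show False using lt sq by simp
  qed
  assume "card P \<le> (n\<^sup>2 + 1)\<^sup>2"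
  then have "card (block_sum ?A) \<le> (n\<^sup>2 + 1)\<^sup>2" using le by simp
  then obtain v where v: "block_sum ?A = translate v (square_block (n\<^sup>2 + 1))"
    using block_sum_minimal[OF A] assms by fastforce
  \<comment> \<open>A priori \<open>P\<close> may have cells outside every instance; the count rules
    them out.\<close>
  then have "block_sum ?A = P"
    using \<open>card P \<le> _\<close> * sub finP sq by (intro card_subset_eq) auto
  then show "shape P = shape (square_block (n\<^sup>2 + 1))"
    using v shape_translate by metis
qed

section \<open>The de Bruijn square\<close>

text \<open>The block of positions \<open>k\<^sup>2, \<dots>, k\<^sup>2 + 2 k\<close> reads \<open>0, k, 1, k, \<dots>, k - 1, k, k\<close>. Together with the
  initial 0 of the next block it contributes exactly the pairs whose maximum is \<open>k\<close>.\<close>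

definition pair_seq :: "nat \<Rightarrow> nat" where
  "pair_seq i = (let k = floor_sqrt i; t = i - k\<^sup>2 in if even t \<and> t < 2 * k then t div 2 else k)"

lemma pair_seq_block:
  assumes "t \<le> 2 * k"
  shows "pair_seq (k\<^sup>2 + t) = (if even t \<and> t < 2 * k then t div 2 else k)"
proof -
  have "floor_sqrt (k\<^sup>2 + t) = k"
    using assms by (intro floor_sqrt_unique) (auto simp: power2_eq_square)
  then show ?thesis by (simp only: pair_seq_def Let_def add_diff_cancel_left')
qed

lemma pair_seq_square: "pair_seq (k\<^sup>2) = 0"
  using pair_seq_block[of 0 k] by simp

lemma pair_seq_less:
  assumes "i < n\<^sup>2"
  shows "pair_seq i < n"
proof -
  have "floor_sqrt i < n"
    using assms by (meson floor_sqrt_power2_le le_less_trans power2_less_imp_less zero_le)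
  then show ?thesis by (auto simp: pair_seq_def Let_def)
qed

text \<open>The pair \<open>(a, b)\<close> starts in the block of its maximum: at offset
  \<open>2 * a\<close> if \<open>a < b\<close>, at offset \<open>2 * b - 1\<close> if
  \<open>0 < b \<le> a\<close>, and at the last offset \<open>2 * a\<close> if
  \<open>b = 0\<close>.\<close>

lemma pair_seq_pair_exists:
  assumes "a < n" "b < n"
  shows "\<exists>i<n\<^sup>2. pair_seq i = a \<and> pair_seq ((i + 1) mod n\<^sup>2) = b"
proof -
  have bound: "k\<^sup>2 + t < n\<^sup>2" if "k < n" "t \<le> 2 * k" for k t
  proof -
    have "k\<^sup>2 + t < (k + 1)\<^sup>2" using that by (simp add: power2_eq_square)
    also have "\<dots> \<le> n\<^sup>2" using that by (intro power_mono) auto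
    finally show ?thesis .
  qed
  \<comment> \<open>Below the last offset the successor lies in the same block, so reduction modulo
    \<open>n\<^sup>2\<close> changes nothing.\<close>
  have inside: ?thesis
    if "k < n" "t < 2 * k" "pair_seq (k\<^sup>2 + t) = a" "pair_seq (k\<^sup>2 + (t + 1)) = b" for k t
    using that bound[of k t] bound[of k "t + 1"] by (intro exI[of _ "k\<^sup>2 + t"]) simp
  consider "a < b" | "b \<le> a" "0 < b" | "b = 0" by linarith
  then show ?thesis
  proof cases
    case 1
    then show ?thesis using assms
      by (intro inside[of b "2 * a"]) (auto simp: pair_seq_block simp del: add_Suc_right)
  next
    case 2
    then show ?thesis using assms
      using pair_seq_block[of "2 * b - 1" a]
      by (intro inside[of a "2 * b - 1"]) (auto simp: pair_seq_block simp del: add_Suc_right)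
  next
    case 3
    \<comment> \<open>The pair straddles two blocks: the next entry opens block \<open>a + 1\<close>
      or, for \<open>a + 1 = n\<close>, wraps around to position 0. It is 0 either way.\<close>
    have next_sq: "a\<^sup>2 + 2 * a + 1 = (a + 1)\<^sup>2" by (simp add: power2_eq_square)
    have "pair_seq ((a\<^sup>2 + 2 * a + 1) mod n\<^sup>2) = 0"
    proof (cases "a + 1 = n")
      case True
      then show ?thesis using pair_seq_square[of 0] unfolding next_sq by simp
    next
      case False
      then have "(a + 1)\<^sup>2 < n\<^sup>2" using assms by (intro power_strict_mono) auto
      then show ?thesis unfolding next_sq by (simp only: mod_less pair_seq_square)
    qed
    moreover have "pair_seq (a\<^sup>2 + 2 * a) = a" by (simp add: pair_seq_block)
    ultimately show ?thesis using 3 bound[of a "2 * a"] assms by blast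
  qed
qed

definition cyclic_pair_seq :: "nat \<Rightarrow> int \<Rightarrow> nat" where
  "cyclic_pair_seq n i = pair_seq (nat (i mod (int n)\<^sup>2)) + 1"

lemma cyclic_pair_seq_range:
  assumes "n > 0"
  shows "cyclic_pair_seq n i \<in> {1..n}"
proof -
  have "nat (i mod (int n)\<^sup>2) < n\<^sup>2"
    using assms by (simp add: nat_less_iff)
  then show ?thesis using pair_seq_less by (fastforce simp: cyclic_pair_seq_def)
qed

lemma cyclic_pair_seq_mod: "i mod (int n)\<^sup>2 = j mod (int n)\<^sup>2 \<Longrightarrow> cyclic_pair_seq n i = cyclic_pair_seq n j"
  by (simp add: cyclic_pair_seq_def)

text \<open>Existence comes from \<open>pair_seq_pair_exists\<close>. Uniqueness is counting:
  \<open>n\<^sup>2\<close> positions mapped onto \<open>n\<^sup>2\<close> pairs hit none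
  twice.\<close>

lemma cyclic_pair_seq_unique:
  assumes "a \<in> {1..n}" "b \<in> {1..n}"
  shows "\<exists>!i. i \<in> {0..<(int n)\<^sup>2} \<and> cyclic_pair_seq n i = a \<and> cyclic_pair_seq n (i + 1) = b"
proof -
  let ?I = "{0..<(int n)\<^sup>2}" and ?h = "\<lambda>i. (cyclic_pair_seq n i, cyclic_pair_seq n (i + 1))"
  have n: "n > 0" using assms by auto
  have surj: "{1..n} \<times> {1..n} \<subseteq> ?h ` ?I"
  proof clarify
    fix a b assume ab: "a \<in> {1..n}" "b \<in> {1..n}"
    then have "a - 1 < n" "b - 1 < n" by auto
    then obtain i where i: "i < n\<^sup>2" "pair_seq i = a - 1" "pair_seq ((i + 1) mod n\<^sup>2) = b - 1"
      using pair_seq_pair_exists by blast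
    have "int i < (int n)\<^sup>2" using i(1) by (metis of_nat_less_iff of_nat_power)
    moreover have "nat ((int i + 1) mod (int n)\<^sup>2) = (i + 1) mod n\<^sup>2"
      by (metis nat_int of_nat_1 of_nat_add of_nat_power of_nat_mod)
    ultimately have "?h (int i) = (a, b)" using i ab by (simp add: cyclic_pair_seq_def)
    then show "(a, b) \<in> ?h ` ?I" using \<open>int i < _\<close> by force
  qed
  have eq: "?h ` ?I = {1..n} \<times> {1..n}"
    using surj cyclic_pair_seq_range[OF n] by blast
  then have "card (?h ` ?I) = card ?I"
    by (simp add: card_cartesian_product power2_eq_square nat_mult_distrib)
  then have inj: "inj_on ?h ?I" by (intro eq_card_imp_inj_on) auto
  moreover have "(a, b) \<in> ?h ` ?I" using eq assms by simp
  ultimately show ?thesis by (auto simp: inj_on_def)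
qed

text \<open>With triangular offsets, columns \<open>x\<close> and \<open>x + 1\<close> are shifted
  against each other by exactly \<open>x\<close>. Over the abscissae of the windows these shifts run
  once through the residues modulo \<open>n\<^sup>2\<close>.\<close>

definition de_bruijn_square :: "nat \<Rightarrow> cell \<Rightarrow> nat" where
  "de_bruijn_square n =
    restrict (\<lambda>(x, y). cyclic_pair_seq n (y + x * (x - 1) div 2)) (square_block (n\<^sup>2 + 1))"

text \<open>Every cell is joined to the origin by going left along its row and then down the first
  column.\<close>

lemma polyomino_square_block:
  assumes "m > 0"
  shows "polyomino (square_block m)"
proof -
  let ?P = "square_block m"
  let ?E = "{(x, y). x \<in> ?P \<and> y \<in> ?P \<and> adjacent x y}"
  have left: "((int k, y), (0, y)) \<in> ?E\<^sup>*" if "(int k, y) \<in> ?P" for k y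
    using that
  proof (induction k)
    case (Suc k)
    then have "((int (Suc k), y), (int k, y)) \<in> ?E" "(int k, y) \<in> ?P"
      by (auto simp: adjacent_def square_block_def)
    then show ?case using Suc.IH by (meson converse_rtrancl_into_rtrancl)
  qed simp
  have down: "((0, int k), (0, 0)) \<in> ?E\<^sup>*" if "(0, int k) \<in> ?P" for k
    using that
  proof (induction k)
    case (Suc k)
    then have "((0, int (Suc k)), (0, int k)) \<in> ?E" "(0, int k) \<in> ?P"
      by (auto simp: adjacent_def square_block_def)
    then show ?case using Suc.IH by (meson converse_rtrancl_into_rtrancl)
  qed simp
  have to0: "(v, (0, 0)) \<in> ?E\<^sup>*" if "v \<in> ?P" for v
  proof -
    obtain x y where v: "v = (int x, int y)"
      using \<open>v \<in> ?P\<close> by (auto simp: square_block_def elim!: nonneg_int_cases)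
    moreover have "(0, int y) \<in> ?P" using that v by (auto simp: square_block_def)
    ultimately show ?thesis using left[of x "int y"] down[of y] that by simp
  qed
  have "sym ?E" by (auto simp: sym_def adjacent_def)
  then have "((0, 0), v) \<in> ?E\<^sup>*" if "v \<in> ?P" for v
    using to0[OF that] by (meson sym_rtrancl symD)
  then have "edge_connected ?P"
    unfolding edge_connected_def using to0 by (meson rtrancl_trans)
  then show ?thesis using assms by (auto simp: polyomino_def square_block_def)
qed

lemma triangle_step: "(x + 1) * x div 2 = x * (x - 1) div 2 + (x::int)"
proof -
  have "(x + 1) * x = x * (x - 1) + x * 2" by (simp add: algebra_simps)
  then show ?thesis by simp
qed

lemma de_bruijn_square_correct:
  assumes "n > 0"
  shows "de_bruijn_polyomino square_tetromino n (square_block (n\<^sup>2 + 1)) (de_bruijn_square n)"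
proof -
  define m where "m = (int n)\<^sup>2"
  define C where "C = cyclic_pair_seq n"
  define T where "T x = x * (x - 1) div 2" for x :: int
  let ?P = "square_block (n\<^sup>2 + 1)" and ?f = "de_bruijn_square n"
  have m: "m > 0" using assms by (simp add: m_def)
  have C_mod: "C i = C j" if "i mod m = j mod m" for i j
    using that cyclic_pair_seq_mod unfolding C_def m_def by blast
  \<comment> \<open>Periodicity carries uniqueness among the residues in \<open>{0..<m}\<close> over
    to arbitrary positions, also across the wrap-around.\<close>
  have C_add: "C (i mod m) = C i" "C (i mod m + 1) = C (i + 1)" for i
    by (rule C_mod; simp add: mod_add_left_eq)+
  have P: "?P = {0..m} \<times> {0..m}" by (auto simp: square_block_def m_def)
  have f: "?f (x, y) = C (y + T x)" if "x \<in> {0..m}" "y \<in> {0..m}" for x y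
    using that unfolding de_bruijn_square_def C_def T_def P by simp
  have T_step: "T (1 + x) = T x + x" for x
    using triangle_step[of x] by (simp add: T_def add.commute)
  \<comment> \<open>A window spans two columns and two rows, so the \<open>m + 1\<close> coordinates
    leave exactly \<open>m\<close> values for each entry of its translation vector.\<close>
  have inst: "translate (x, y) square_tetromino \<subseteq> ?P \<longleftrightarrow> x \<in> {0..<m} \<and> y \<in> {0..<m}" for x y
    unfolding translate_square_tetromino P by auto
  have "?f \<in> colorings n ?P"
    using cyclic_pair_seq_range[OF assms] by (auto simp: colorings_def de_bruijn_square_def)
  moreover have "\<exists>!v. translate v square_tetromino \<subseteq> ?P \<and> (\<forall>u\<in>square_tetromino. ?f (u + v) = c u)"
    if c: "c \<in> colorings n square_tetromino" for c
  proof -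
    have cr: "c (0, 0) \<in> {1..n}" "c (0, 1) \<in> {1..n}" "c (1, 0) \<in> {1..n}" "c (1, 1) \<in> {1..n}"
      using c by (auto simp: colorings_def square_tetromino_def PiE_def Pi_def)
    obtain i where i: "i \<in> {0..<m}" "C i = c (0, 0)" "C (i + 1) = c (0, 1)"
      and i_unique: "\<And>k. k \<in> {0..<m} \<Longrightarrow> C k = c (0, 0) \<Longrightarrow> C (k + 1) = c (0, 1) \<Longrightarrow> k = i"
      using cyclic_pair_seq_unique[OF cr(1,2)] unfolding C_def m_def by blast
    obtain j where j: "j \<in> {0..<m}" "C j = c (1, 0)" "C (j + 1) = c (1, 1)"
      and j_unique: "\<And>k. k \<in> {0..<m} \<Longrightarrow> C k = c (1, 0) \<Longrightarrow> C (k + 1) = c (1, 1) \<Longrightarrow> k = j"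
      using cyclic_pair_seq_unique[OF cr(3,4)] unfolding C_def m_def by blast
    \<comment> \<open>The left column of the window starts at position \<open>y + T x\<close> of the
      sequence, the right one at \<open>y + T (x + 1)\<close>, which is \<open>x\<close> further.
      These positions must be \<open>i\<close> and \<open>j\<close> modulo \<open>m\<close>.\<close>
    have window: "(\<forall>u\<in>square_tetromino. ?f (u + (x, y)) = c u) \<longleftrightarrow>
        (y + T x) mod m = i \<and> (y + T x + x) mod m = j" (is "?L \<longleftrightarrow> ?R")
      if xy: "x \<in> {0..<m}" "y \<in> {0..<m}" for x y
    proof -
      have "?L \<longleftrightarrow> C (y + T x) = c (0, 0) \<and> C (y + T x + 1) = c (0, 1)
          \<and> C (y + T x + x) = c (1, 0) \<and> C (y + T x + x + 1) = c (1, 1)"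
        using xy f[of x y] f[of x "y + 1"] f[of "x + 1" y] f[of "x + 1" "y + 1"]
        by (simp add: square_tetromino_def T_step add_ac conj_ac)
      also have "\<dots> \<longleftrightarrow> ?R"
        using i j i_unique[of "(y + T x) mod m"] j_unique[of "(y + T x + x) mod m"] C_add m
        by auto
      finally show ?thesis .
    qed
    show ?thesis
    proof (rule ex1I)
      \<comment> \<open>The two congruences are solved in turn: their difference gives
        \<open>x\<close>, then the first one gives \<open>y\<close>.\<close>
      define x where "x = (j - i) mod m"
      define y where "y = (i - T x) mod m"
      have xy: "x \<in> {0..<m}" "y \<in> {0..<m}" using m by (auto simp: x_def y_def)
      have yi: "(y + T x) mod m = i" using i(1) by (simp add: y_def mod_add_left_eq)
      have "(y + T x + x) mod m = (i + x) mod m" using yi mod_add_left_eq by metis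
      also have "\<dots> = j" using j(1) by (simp add: x_def mod_add_right_eq)
      finally show "translate (x, y) square_tetromino \<subseteq> ?P
          \<and> (\<forall>u\<in>square_tetromino. ?f (u + (x, y)) = c u)"
        using window[OF xy] xy inst yi by simp
      fix v assume v: "translate v square_tetromino \<subseteq> ?P \<and> (\<forall>u\<in>square_tetromino. ?f (u + v) = c u)"
      obtain x' y' where v': "v = (x', y')" by fastforce
      then have xy': "x' \<in> {0..<m}" "y' \<in> {0..<m}" using v inst by auto
      then have e: "(y' + T x') mod m = i" "(y' + T x' + x') mod m = j"
        using v window[OF xy'] v' by auto
      \<comment> \<open>The same subtraction recovers any other solution modulo \<open>m\<close>,
        and its entries are their own residues.\<close>
      have "x = (y' + T x' + x' - (y' + T x')) mod m"
        unfolding x_def e[symmetric] by (rule mod_diff_eq)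
      then have x': "x = x'" using xy' by simp
      have "y = (y' + T x' - T x') mod m"
        unfolding y_def x' e(1)[symmetric] by (rule mod_diff_left_eq)
      then show "v = (x, y)" using xy' x' v' by simp
    qed
  qed
  ultimately show ?thesis
    using polyomino_square_block[of "n\<^sup>2 + 1"] by (simp add: de_bruijn_polyomino_def)
qed

theorem theorem4p4:
  fixes n :: nat
  assumes "n > 0"
  shows "{shape P | P. \<exists>f. prismatic_polyomino square_tetromino n P f}
       = {shape (square_block (n\<^sup>2 + 1))}"
proof -
  let ?S = "square_block (n\<^sup>2 + 1)"
  note card_S = card_square_block[of "n\<^sup>2 + 1"]
  have "prismatic_polyomino square_tetromino n ?S (de_bruijn_square n)"
    using de_bruijn_square_correct[OF assms] de_bruijn_square_tetromino_lower(1) assms card_S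
    by (auto simp: prismatic_polyomino_def)
  \<comment> \<open>Minimality of \<open>P\<close> against the colored square supplies the upper
    bound on \<open>card P\<close> that fixes the shape.\<close>
  moreover have "shape P = shape ?S" if "prismatic_polyomino square_tetromino n P f" for P f
    using that de_bruijn_square_correct[OF assms] de_bruijn_square_tetromino_lower(2)[OF _ assms] card_S
    unfolding prismatic_polyomino_def by metis
  ultimately show ?thesis by blast
qed

end
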